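(* Let $\{F^{ij}\}_{1\le i<j\le 4}$ be a sextuple of real fundamental matrices such that $$e_1^2=e_1^3\neq e_1^4,\qquad e_2^1=e_2^3\neq e_2^4,\qquad e_3^1=e_3^2\neq e_3^4,$$ and such that $e_4^1,e_4^2,e_4^3$ are distinct and lie on a line in $\mathbb{P}^2$ (all equalities and inequalities of epipoles being as points of $\mathbb{P}^2$). Then $\{F^{ij}\}$ is compatible if and only if each triple $\{F^{ij},F^{ik},F^{jk}\}$, for distinct $i,j,k\in\{1,2,3,4\}$, is compatible.
   Context: Everything is over $\mathbb{R}$. A camera is a rank-3 real $3\times 4$ matrix (up to nonzero scale); a fundamental matrix is a rank-2 real $3\times 3$ matrix (up to nonzero scale). For $3\times 4$ matrices $P_1,P_2$, $\psi(P_1,P_2)$ is the $3\times3$ matrix $F$ (up to scale) with $\det\begin{bmatrix}P_1&x&0\\P_2&0&y\end{bmatrix}=x^TFy$ for all $x,y\in\mathbb{R}^3$. Convention: $F^{ji}=(F^{ij})^T$. A set $\{F^{ij}\}$ is compatible if there are cameras $P_i$, one for each index occurring, with $F^{ij}=\psi(P_i,P_j)$ up to nonzero scale for all given $(i,j)$. The epipole $e_j^i$ (the $i$-th epipole in the $j$-th image) is a vector spanning $\ker F^{ij}$, viewed as a point of $\mathbb{P}^2$. *)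

theory Defs
  imports "HOL-Analysis.Analysis"
begin

text \<open>
  Matrices and vectors taken up to nonzero scale are given by representatives, and
  equality up to scale is the relation \<open>scale_eq\<close>. The type \<open>real^4^3\<close> consists of the
  \<open>3 \<times> 4\<close> matrices (3 rows, 4 columns).
\<close>

definition scale_eq :: "'a::real_vector \<Rightarrow> 'a \<Rightarrow> bool"
  where "scale_eq u v \<longleftrightarrow> (\<exists>c::real. c \<noteq> 0 \<and> u = c *\<^sub>R v)"

definition camera :: "real^4^3 \<Rightarrow> bool"
  where "camera P \<longleftrightarrow> rank P = 3"

definition fundamental_matrix :: "real^3^3 \<Rightarrow> bool"
  where "fundamental_matrix F \<longleftrightarrow> rank F = 2"

definition two_view_matrix :: "real^4^3 \<Rightarrow> real^4^3 \<Rightarrow> real^3 \<Rightarrow> real^3 \<Rightarrow> real^6^6"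
  where "two_view_matrix P Q x y = vector
    [vector [P$1$1, P$1$2, P$1$3, P$1$4, x$1, 0],
     vector [P$2$1, P$2$2, P$2$3, P$2$4, x$2, 0],
     vector [P$3$1, P$3$2, P$3$3, P$3$4, x$3, 0],
     vector [Q$1$1, Q$1$2, Q$1$3, Q$1$4, 0, y$1],
     vector [Q$2$1, Q$2$2, Q$2$3, Q$2$4, 0, y$2],
     vector [Q$3$1, Q$3$2, Q$3$3, Q$3$4, 0, y$3]]"

text \<open>This is well defined for all \<open>P\<close> and \<open>Q\<close>, see \<open>psi_ex1\<close> below.\<close>

definition psi :: "real^4^3 \<Rightarrow> real^4^3 \<Rightarrow> real^3^3"
  where "psi P Q = (THE F. \<forall>x y. det (two_view_matrix P Q x y) = x \<bullet> (F *v y))"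

text \<open>
  A family of matrices \<open>F i j\<close> (written \<open>F\<^sup>i\<^sup>j\<close> on paper), given for the index pairs
  \<open>(i, j) \<in> E\<close>; the values of \<open>F\<close> outside \<open>E\<close> are irrelevant.
\<close>

definition compatible :: "(nat \<times> nat) set \<Rightarrow> (nat \<Rightarrow> nat \<Rightarrow> real^3^3) \<Rightarrow> bool"
  where "compatible E F \<longleftrightarrow>
    (\<exists>P :: nat \<Rightarrow> real^4^3.
      (\<forall>i \<in> fst ` E \<union> snd ` E. camera (P i)) \<and>
      (\<forall>(i, j) \<in> E. scale_eq (F i j) (psi (P i) (P j))))"

text \<open>For \<open>F = F\<^sup>i\<^sup>j\<close> this says that \<open>e\<close> represents the \<open>i\<close>-th epipole in the \<open>j\<close>-th image.\<close>

definition spans_kernel :: "real^3 \<Rightarrow> real^3^3 \<Rightarrow> bool"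
  where "spans_kernel e F \<longleftrightarrow> span {e} = {y. F *v y = 0}"

text \<open>A line in the projective plane is given by a nonzero covector, up to scale.\<close>

definition on_common_line :: "(real^3) set \<Rightarrow> bool"
  where "on_common_line S \<longleftrightarrow> (\<exists>l. l \<noteq> 0 \<and> (\<forall>v \<in> S. l \<bullet> v = 0))"

lemma exhaust_6:
  fixes x :: 6
  shows "x = 1 \<or> x = 2 \<or> x = 3 \<or> x = 4 \<or> x = 5 \<or> x = 6"
proof (induct x)
  case (of_int z)
  then have "z = 0 \<or> z = 1 \<or> z = 2 \<or> z = 3 \<or> z = 4 \<or> z = 5" by fastforce
  then show ?case by auto
qed

lemma forall_6: "(\<forall>i::6. P i) \<longleftrightarrow> P 1 \<and> P 2 \<and> P 3 \<and> P 4 \<and> P 5 \<and> P 6"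
  by (metis exhaust_6)

lemma vector_6 [simp]:
  "(vector [a,b,c,d,e,f] :: ('a::zero)^6)$1 = a"
  "(vector [a,b,c,d,e,f] :: ('a::zero)^6)$2 = b"
  "(vector [a,b,c,d,e,f] :: ('a::zero)^6)$3 = c"
  "(vector [a,b,c,d,e,f] :: ('a::zero)^6)$4 = d"
  "(vector [a,b,c,d,e,f] :: ('a::zero)^6)$5 = e"
  "(vector [a,b,c,d,e,f] :: ('a::zero)^6)$6 = f"
  unfolding vector_def by simp_all

lemma linear_det_row:
  fixes R :: "'n::finite \<Rightarrow> real^'n" and f :: "'a::real_vector \<Rightarrow> real^'n"
  assumes "linear f"
  shows "linear (\<lambda>x. det (\<chi> i. if i = k then f x else R i))"
proof (rule linearI)
  show "det (\<chi> i. if i = k then f (x + y) else R i) =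
      det (\<chi> i. if i = k then f x else R i) + det (\<chi> i. if i = k then f y else R i)" for x y
    unfolding linear_add[OF assms] by (rule det_row_add)
  show "det (\<chi> i. if i = k then f (c *\<^sub>R x) else R i) =
      c *\<^sub>R det (\<chi> i. if i = k then f x else R i)" for c x
    unfolding linear_cmul[OF assms] real_scaleR_def
    using det_row_mul[of k c "\<lambda>_. f x" R] unfolding scalar_mult_eq_scaleR .
qed

lemma linear_two_view_left: "linear (\<lambda>x. det (two_view_matrix P Q x y))"
proof -
  let ?f = "\<lambda>x::real^3. (vector [x$1, x$2, x$3, 0, 0, 0] :: real^6)"
  have lin: "linear ?f"
    by (rule linearI) (simp_all add: vec_eq_iff forall_6)
  have "transpose (two_view_matrix P Q x y) =
      (\<chi> i. if i = 5 then ?f x else transpose (two_view_matrix P Q 0 y) $ i)" for x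
    by (simp add: vec_eq_iff forall_6 transpose_def two_view_matrix_def)
  then have "det (two_view_matrix P Q x y) =
      det (\<chi> i. if i = 5 then ?f x else transpose (two_view_matrix P Q 0 y) $ i)" for x
    by (metis det_transpose)
  then show ?thesis
    using linear_det_row[OF lin, of 5 "\<lambda>i. transpose (two_view_matrix P Q 0 y) $ i"] by simp
qed

lemma linear_two_view_right: "linear (\<lambda>y. det (two_view_matrix P Q x y))"
proof -
  let ?f = "\<lambda>y::real^3. (vector [0, 0, 0, y$1, y$2, y$3] :: real^6)"
  have lin: "linear ?f"
    by (rule linearI) (simp_all add: vec_eq_iff forall_6)
  have "transpose (two_view_matrix P Q x y) =
      (\<chi> i. if i = 6 then ?f y else transpose (two_view_matrix P Q x 0) $ i)" for y
    by (simp add: vec_eq_iff forall_6 transpose_def two_view_matrix_def)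
  then have "det (two_view_matrix P Q x y) =
      det (\<chi> i. if i = 6 then ?f y else transpose (two_view_matrix P Q x 0) $ i)" for y
    by (metis det_transpose)
  then show ?thesis
    using linear_det_row[OF lin, of 6 "\<lambda>i. transpose (two_view_matrix P Q x 0) $ i"] by simp
qed

lemma psi_ex1: "\<exists>!F. \<forall>x y. det (two_view_matrix P Q x y) = x \<bullet> (F *v y)"
proof (rule ex_ex1I)
  define d where "d x y = det (two_view_matrix P Q x y)" for x y
  define F :: "real^3^3" where "F = (\<chi> i j. d (axis i 1) (axis j 1))"
  have expand: "x = (\<Sum>i\<in>UNIV. x$i *\<^sub>R axis i 1)" for x :: "real^3"
    using basis_expansion[of x] by (simp add: scalar_mult_eq_scaleR)
  have left: "d x y = (\<Sum>i\<in>UNIV. x$i * d (axis i 1) y)" for x y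
    by (subst expand[of x])
      (simp add: linear_sum[OF linear_two_view_left[of P Q y, folded d_def]]
        linear_cmul[OF linear_two_view_left[of P Q y, folded d_def]])
  have right: "d x y = (\<Sum>j\<in>UNIV. y$j * d x (axis j 1))" for x y
    by (subst expand[of y])
      (simp add: linear_sum[OF linear_two_view_right[of P Q x, folded d_def]]
        linear_cmul[OF linear_two_view_right[of P Q x, folded d_def]])
  have "d x y = x \<bullet> (F *v y)" for x y
    unfolding left[of x y] right[of "axis _ 1" y]
    by (simp add: F_def inner_vec_def matrix_vector_mult_def mult.commute)
  then show "\<exists>F. \<forall>x y. det (two_view_matrix P Q x y) = x \<bullet> (F *v y)"
    unfolding d_def by blast
next
  fix F G :: "real^3^3"
  assume "\<forall>x y. det (two_view_matrix P Q x y) = x \<bullet> (F *v y)"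
    and "\<forall>x y. det (two_view_matrix P Q x y) = x \<bullet> (G *v y)"
  then have "x \<bullet> (F *v y) = x \<bullet> (G *v y)" for x y
    by metis
  then have "F *v y = G *v y" for y
    by (metis vector_eq_ldot)
  then show "F = G"
    by (simp add: matrix_eq)
qed

lemma psi_det: "det (two_view_matrix P Q x y) = x \<bullet> (psi P Q *v y)"
  using theI'[OF psi_ex1[of P Q]] unfolding psi_def by blast

end

theory Submission
  imports Defs
begin

text \<open>
  Since \<open>e\<^sub>1\<^sup>2 = e\<^sub>1\<^sup>3\<close>, the centers of cameras 1, 2, 3 lie on a line. A pair of cameras is
  determined by its fundamental matrix up to projective transformations, so solutions for the
  triples 124 and 134 can be aligned to have cameras 1 and 4 in common. It remains to see that
  cameras 2 and 3 of the aligned solutions induce \<open>F\<^sup>2\<^sup>3\<close>. Their centers differ, because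
  \<open>e\<^sub>4\<^sup>2 \<noteq> e\<^sub>4\<^sup>3\<close>; and for distinct collinear centers the correspondence between images 2 and 3
  is the one of the planes through the baseline, hence is determined by \<open>F\<^sup>1\<^sup>2\<close> and \<open>F\<^sup>1\<^sup>3\<close>.
  Any solution for the triple 123 therefore shows that this correspondence is \<open>F\<^sup>2\<^sup>3\<close>.
\<close>

section \<open>Bilinear forms with the same zeros\<close>

text \<open>With one argument fixed, two functionals with the same kernel are proportional, so the
  ratio \<open>f x y / g x y\<close> is constant along rows and columns wherever \<open>g\<close> is
  nonzero. Joining any two such places makes the constant global. This recovers a matrix up to scale
  from the zeros of its form.\<close>

lemma same_zeros_imp_proportional:
  fixes f g :: "'a::real_vector \<Rightarrow> 'b::real_vector \<Rightarrow> real"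
  assumes lf: "\<And>y. linear (\<lambda>x. f x y)" "\<And>x. linear (f x)"
    and lg: "\<And>y. linear (\<lambda>x. g x y)" "\<And>x. linear (g x)"
    and zeros: "\<And>x y. f x y = 0 \<longleftrightarrow> g x y = 0"
  shows "\<exists>c. c \<noteq> 0 \<and> (\<forall>x y. f x y = c * g x y)"
proof -
  have right: "f x y * g x y' = f x y' * g x y" for x y y'
  proof -
    \<comment> \<open>This combination of \<open>y\<close> and \<open>y'\<close> is built to lie in
      the kernel of \<open>g x\<close>, hence also in that of \<open>f x\<close>.\<close>
    have "g x (g x y *\<^sub>R y' - g x y' *\<^sub>R y) = 0"
      by (simp add: linear_diff[OF lg(2)] linear_cmul[OF lg(2)])
    then have "f x (g x y *\<^sub>R y' - g x y' *\<^sub>R y) = 0"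
      by (simp only: zeros)
    then show ?thesis
      by (simp add: linear_diff[OF lf(2)] linear_cmul[OF lf(2)] mult.commute)
  qed
  have left: "f x y * g x' y = f x' y * g x y" for x x' y
  proof -
    have "g (g x y *\<^sub>R x' - g x' y *\<^sub>R x) y = 0"
      by (simp add: linear_diff[OF lg(1)] linear_cmul[OF lg(1)])
    then have "f (g x y *\<^sub>R x' - g x' y *\<^sub>R x) y = 0"
      by (simp only: zeros)
    then show ?thesis
      by (simp add: linear_diff[OF lf(1)] linear_cmul[OF lf(1)] mult.commute)
  qed
  define q where "q x y = f x y / g x y" for x y
  have q_right: "q x y = q x y'" if "g x y \<noteq> 0" "g x y' \<noteq> 0" for x y y'
    using that right[of x y y'] by (simp add: q_def field_simps)
  have q_left: "q x y = q x' y" if "g x y \<noteq> 0" "g x' y \<noteq> 0" for x x' y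
    using that left[of x y x'] by (simp add: q_def field_simps)
  show ?thesis
  proof (cases "\<exists>x y. g x y \<noteq> 0")
    case True
    then obtain a b where ab: "g a b \<noteq> 0"
      by blast
    have "q x y = q a b" if xy: "g x y \<noteq> 0" for x y
    proof (cases "g x b \<noteq> 0 \<or> g a y \<noteq> 0")
      case True
      then show ?thesis
        by (metis ab q_left q_right xy)
    next
      case False
      \<comment> \<open>Both corners between (x, y) and (a, b) are zeros of \<open>g\<close>; the
        row \<open>x + a\<close> then takes the values \<open>g x y\<close> and \<open>g a b\<close>
        and joins the two places.\<close>
      then have "g (x + a) y \<noteq> 0" "g (x + a) b \<noteq> 0"
        using xy ab by (simp_all add: linear_add[OF lg(1)])
      then show ?thesis
        by (metis ab q_left q_right xy)
    qed
    then have "f x y = q a b * g x y" for x y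
      by (cases "g x y = 0") (auto simp: zeros q_def divide_simps)
    moreover have "q a b \<noteq> 0"
      using ab zeros by (simp add: q_def)
    ultimately show ?thesis
      by blast
  next
    case False
    then show ?thesis
      using zeros by (intro exI[of _ 1]) auto
  qed
qed

section \<open>Epipolar correspondence\<close>

definition corresponds :: "real^4^3 \<Rightarrow> real^4^3 \<Rightarrow> real^3 \<Rightarrow> real^3 \<Rightarrow> bool"
  where "corresponds P Q x y \<longleftrightarrow>
    (\<exists>X s t. (X \<noteq> 0 \<or> s \<noteq> 0 \<or> t \<noteq> 0) \<and> P *v X = s *\<^sub>R x \<and> Q *v X = t *\<^sub>R y)"

lemma vector_4:
  "(vector [a, b, c, d] :: ('a::zero)^4) $ 1 = a"
  "(vector [a, b, c, d] :: ('a::zero)^4) $ 2 = b"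
  "(vector [a, b, c, d] :: ('a::zero)^4) $ 3 = c"
  "(vector [a, b, c, d] :: ('a::zero)^4) $ 4 = d"
  unfolding vector_def by simp_all

lemma det_eq_0_iff_kernel:
  fixes A :: "real^'n^'n"
  shows "det A = 0 \<longleftrightarrow> (\<exists>x. x \<noteq> 0 \<and> A *v x = 0)"
  using invertible_det_nz[of A] invertible_left_inverse[of A] matrix_left_invertible_ker[of A]
  by blast

lemma UNIV_6: "(UNIV::6 set) = {1, 2, 3, 4, 5, 6}"
  using exhaust_6 by auto

lemma sum_6: "sum f (UNIV::6 set) = f 1 + f 2 + f 3 + f 4 + f 5 + f 6"
  unfolding UNIV_6 by (simp add: ac_simps)

lemma two_view_matrix_kernel:
  "two_view_matrix P Q x y *v v = 0 \<longleftrightarrow>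
    P *v vector [v$1, v$2, v$3, v$4] = (- v$5) *\<^sub>R x \<and>
    Q *v vector [v$1, v$2, v$3, v$4] = (- v$6) *\<^sub>R y"
  by (simp add: vec_eq_iff forall_6 forall_3 matrix_vector_mult_def sum_4 sum_6
      two_view_matrix_def vector_4 algebra_simps eq_neg_iff_add_eq_0)

lemma det_two_view_matrix_eq_0_iff:
  "det (two_view_matrix P Q x y) = 0 \<longleftrightarrow> corresponds P Q x y"
proof
  assume "det (two_view_matrix P Q x y) = 0"
  then obtain v where v: "v \<noteq> 0" "two_view_matrix P Q x y *v v = 0"
    using det_eq_0_iff_kernel by blast
  have "(vector [v$1, v$2, v$3, v$4] :: real^4) \<noteq> 0 \<or> - v$5 \<noteq> 0 \<or> - v$6 \<noteq> 0"
    using v(1) by (auto simp: vec_eq_iff forall_4 forall_6 vector_4)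
  with v(2) show "corresponds P Q x y"
    unfolding two_view_matrix_kernel corresponds_def by blast
next
  assume "corresponds P Q x y"
  then obtain X s t where X: "X \<noteq> 0 \<or> s \<noteq> 0 \<or> t \<noteq> 0"
    and PQ: "P *v X = s *\<^sub>R x" "Q *v X = t *\<^sub>R y"
    unfolding corresponds_def by blast
  define v :: "real^6" where "v = vector [X$1, X$2, X$3, X$4, - s, - t]"
  have "vector [v$1, v$2, v$3, v$4] = X"
    by (simp add: v_def vec_eq_iff forall_4 vector_4)
  then have "two_view_matrix P Q x y *v v = 0"
    unfolding two_view_matrix_kernel using PQ by (simp add: v_def)
  moreover have "v \<noteq> 0"
    using X by (auto simp: v_def vec_eq_iff forall_4 forall_6)
  ultimately show "det (two_view_matrix P Q x y) = 0"
    using det_eq_0_iff_kernel by blast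
qed

text \<open>A form of "F is psi(P, Q) up to scale" that mentions neither the scalar nor the
  determinant, only the zero set.\<close>

definition epipolar :: "real^3^3 \<Rightarrow> real^4^3 \<Rightarrow> real^4^3 \<Rightarrow> bool"
  where "epipolar F P Q \<longleftrightarrow> (\<forall>x y. x \<bullet> (F *v y) = 0 \<longleftrightarrow> corresponds P Q x y)"

lemma linear_bilinear_form:
  fixes F :: "real^'n^'m"
  shows "linear (\<lambda>x. x \<bullet> (F *v y))" "linear (\<lambda>y. x \<bullet> (F *v y))"
  by (auto intro!: linearI simp: inner_left_distrib inner_right_distrib
      matrix_vector_right_distrib matrix_vector_mult_scaleR)

text \<open>The form of \<open>psi P Q\<close> is the two-view determinant, which vanishes exactly
  on corresponding pairs. Hence \<open>epipolar\<close> says that two bilinear forms have the same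
  zeros, and these are proportional.\<close>

lemma scale_eq_psi_iff: "scale_eq F (psi P Q) \<longleftrightarrow> epipolar F P Q"
proof
  assume "scale_eq F (psi P Q)"
  then show "epipolar F P Q"
    by (auto simp: scale_eq_def epipolar_def scaleR_matrix_vector_assoc[symmetric]
        psi_det[symmetric] det_two_view_matrix_eq_0_iff)
next
  assume "epipolar F P Q"
  then have "x \<bullet> (F *v y) = 0 \<longleftrightarrow> x \<bullet> (psi P Q *v y) = 0" for x y
    by (simp add: epipolar_def psi_det[symmetric] det_two_view_matrix_eq_0_iff)
  then obtain c where c: "c \<noteq> 0" "\<And>x y. x \<bullet> (F *v y) = c * (x \<bullet> (psi P Q *v y))"
    using same_zeros_imp_proportional[of "\<lambda>x y. x \<bullet> (F *v y)" "\<lambda>x y. x \<bullet> (psi P Q *v y)"]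
    by (auto intro: linear_bilinear_form)
  then have "x \<bullet> (F *v y) = x \<bullet> ((c *\<^sub>R psi P Q) *v y)" for x y
    by (simp add: scaleR_matrix_vector_assoc[symmetric])
  then have "F = c *\<^sub>R psi P Q"
    by (metis matrix_eq vector_eq_ldot)
  with c(1) show "scale_eq F (psi P Q)"
    unfolding scale_eq_def by blast
qed

lemma corresponds_commute: "corresponds P Q x y \<longleftrightarrow> corresponds Q P y x"
  unfolding corresponds_def by blast

lemma epipolar_transpose: "epipolar F P Q \<Longrightarrow> epipolar (transpose F) Q P"
  unfolding epipolar_def
  by (metis corresponds_commute dot_lmul_matrix inner_commute transpose_matrix_vector)

section \<open>Changes of coordinates and of scale\<close>

lemma corresponds_mult_imp:
  assumes "inj ((*v) H)" "corresponds (P ** H) (Q ** H) x y"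
  shows "corresponds P Q x y"
proof -
  obtain X s t where X: "X \<noteq> 0 \<or> s \<noteq> 0 \<or> t \<noteq> 0"
    and PQ: "P ** H *v X = s *\<^sub>R x" "Q ** H *v X = t *\<^sub>R y"
    using assms(2) unfolding corresponds_def by blast
  have "H *v X \<noteq> 0 \<or> s \<noteq> 0 \<or> t \<noteq> 0"
    using X assms(1) by (metis injD matrix_vector_mult_0_right)
  with PQ show ?thesis
    unfolding corresponds_def by (metis matrix_vector_mul_assoc)
qed

text \<open>The transformation only renames the points X of space. The converse implication is the
  same renaming by the inverse \<open>K\<close>.\<close>

lemma epipolar_mult:
  fixes H :: "real^4^4"
  assumes H: "inj ((*v) H)" and F: "epipolar F P Q"
  shows "epipolar F (P ** H) (Q ** H)"
proof -
  obtain K where K: "K ** H = mat 1"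
    using H matrix_left_invertible_injective by blast
  then have HK: "H ** K = mat 1"
    using matrix_left_right_inverse by blast
  then have "inj ((*v) K)"
    using matrix_left_invertible_injective by blast
  then have "corresponds P Q x y \<Longrightarrow> corresponds (P ** H) (Q ** H) x y" for x y
    using corresponds_mult_imp[of K "P ** H" "Q ** H"] HK
    by (simp add: matrix_mul_assoc[symmetric])
  then show ?thesis
    using F corresponds_mult_imp[OF H] unfolding epipolar_def by blast
qed

lemma camera_mult:
  fixes H :: "real^4^4"
  assumes "inj ((*v) H)" "camera P"
  shows "camera (P ** H)"
proof -
  have "surj ((*v) H)"
    using assms(1) linear_injective_imp_surjective matrix_vector_mul_linear by blast
  moreover have "surj ((*v) P)"
    using assms(2) full_rank_surjective[of P] by (simp add: camera_def)
  ultimately have "surj ((*v) P \<circ> (*v) H)"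
    by (rule comp_surj)
  moreover have "(*v) P \<circ> (*v) H = (*v) (P ** H)"
    by (auto simp: matrix_vector_mul_assoc)
  ultimately show ?thesis
    using full_rank_surjective[of "P ** H"] by (simp add: camera_def)
qed

lemma corresponds_scale_right_imp:
  assumes "c \<noteq> 0" "corresponds P Q x y"
  shows "corresponds P (c *\<^sub>R Q) x y"
proof -
  obtain X s t where X: "X \<noteq> 0 \<or> s \<noteq> 0 \<or> t \<noteq> 0" "P *v X = s *\<^sub>R x" "Q *v X = t *\<^sub>R y"
    using assms(2) unfolding corresponds_def by blast
  then have "(c *\<^sub>R Q) *v X = (c * t) *\<^sub>R y"
    by (simp add: scaleR_matrix_vector_assoc[symmetric])
  moreover have "X \<noteq> 0 \<or> s \<noteq> 0 \<or> c * t \<noteq> 0"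
    using X(1) assms(1) by simp
  ultimately show ?thesis
    unfolding corresponds_def using X(2) by blast
qed

lemma corresponds_scale_right:
  assumes "c \<noteq> 0"
  shows "corresponds P (c *\<^sub>R Q) x y \<longleftrightarrow> corresponds P Q x y"
proof
  assume "corresponds P (c *\<^sub>R Q) x y"
  then show "corresponds P Q x y"
    using assms corresponds_scale_right_imp[of "1 / c" P "c *\<^sub>R Q" x y] by simp
qed (rule corresponds_scale_right_imp[OF assms])

lemma epipolar_scale_left:
  assumes "c \<noteq> 0"
  shows "epipolar F (c *\<^sub>R P) Q \<longleftrightarrow> epipolar F P Q"
  unfolding epipolar_def
  using corresponds_scale_right[OF assms, of Q P] corresponds_commute[of Q] by metis

text \<open>A common center is a witness with s = t = 0 for every x and y. Used in the
  contrapositive: a nonzero matrix forces distinct centers.\<close>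

lemma epipolar_common_center:
  assumes "epipolar F P Q" "X \<noteq> 0" "P *v X = 0" "Q *v X = 0"
  shows "F = 0"
proof -
  have "corresponds P Q x y" for x y
    unfolding corresponds_def using assms(2-4) by (intro exI[of _ X] exI[of _ 0]) simp
  then have "x \<bullet> (F *v y) = 0" for x y
    using assms(1) by (simp add: epipolar_def)
  then have "x \<bullet> (F *v y) = x \<bullet> (0 *v y)" for x y
    by simp
  then show ?thesis
    by (metis matrix_eq vector_eq_ldot)
qed

text \<open>The center of \<open>P\<close> is a witness with s = 0, t = 1 for every x, so its image
  under \<open>Q\<close> is orthogonal to nothing less than all of x composed with F: it lies in the
  kernel and is an epipole if nonzero.\<close>

lemma epipolar_epipole:
  assumes "epipolar F P Q" "P *v X = 0"
  shows "F *v (Q *v X) = 0"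
proof -
  have "corresponds P Q x (Q *v X)" for x
    unfolding corresponds_def using assms(2)
    by (intro exI[of _ X] exI[of _ 0] exI[of _ 1]) simp
  then have "x \<bullet> (F *v (Q *v X)) = 0" for x
    using assms(1) by (simp add: epipolar_def)
  then show ?thesis
    by (metis inner_eq_zero_iff)
qed

section \<open>Cameras in block form\<close>

text \<open>The block matrix [A|a]. Together with \<open>hom\<close>, it reduces the geometry of
  space to algebra in three dimensions.\<close>

definition cam :: "real^3^3 \<Rightarrow> real^3 \<Rightarrow> real^4^3"
  where "cam A a = (\<chi> i. vector [A$i$1, A$i$2, A$i$3, a$i])"

definition hom :: "real^3 \<Rightarrow> real \<Rightarrow> real^4"
  where "hom z t = vector [z$1, z$2, z$3, t]"

lemma cam_mult_hom: "cam A a *v hom z t = A *v z + t *\<^sub>R a"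
  by (simp add: vec_eq_iff cam_def hom_def matrix_vector_mult_def sum_4 sum_3 vector_4)

lemma hom_cases: obtains z t where "X = hom z t"
  by (rule that[of "vector [X$1, X$2, X$3]" "X$4"])
    (simp add: hom_def vec_eq_iff forall_4 vector_4 vector_3)

lemma hom_eq_0_iff: "hom z t = 0 \<longleftrightarrow> z = 0 \<and> t = 0"
  by (auto simp: hom_def vec_eq_iff forall_4 forall_3 vector_4)

lemma cam_cases: obtains A a where "P = cam A a"
  by (rule that[of "\<chi> i. vector [P$i$1, P$i$2, P$i$3]" "\<chi> i. P$i$4"])
    (simp add: cam_def vec_eq_iff forall_4 vector_4 vector_3)

lemma cam_eqI:
  assumes "\<And>z t. P *v hom z t = A *v z + t *\<^sub>R a"
  shows "P = cam A a"
proof -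
  have "P *v X = cam A a *v X" for X
    by (cases X rule: hom_cases) (simp add: assms cam_mult_hom)
  then show ?thesis
    by (simp add: matrix_eq)
qed

text \<open>The columns of \<open>H\<close> are those of a right inverse of \<open>P\<close>,
  followed by its center. \<open>P\<close> then reads off z, and the nonzero center leaves no
  freedom in t.\<close>

lemma camera_normal_form:
  assumes "camera P"
  obtains H :: "real^4^4" where "inj ((*v) H)" "P ** H = cam (mat 1) 0"
proof -
  have rank: "rank P = 3"
    using assms by (simp add: camera_def)
  then have "surj ((*v) P)"
    using full_rank_surjective[of P] by simp
  then obtain R where R: "P ** R = mat 1"
    using matrix_right_invertible_surjective by blast
  obtain c where c: "c \<noteq> 0" "P *v c = 0"
    using matrix_nonfull_linear_equations_eq[of P] rank by auto
  define h where "h X = R *v vector [X$1, X$2, X$3] + X$4 *\<^sub>R c" for X :: "real^4"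
  have "vector [(X + Y)$1, (X + Y)$2, (X + Y)$3]
      = (vector [X$1, X$2, X$3] + vector [Y$1, Y$2, Y$3] :: real^3)" for X Y :: "real^4"
    by (simp add: vec_eq_iff forall_3)
  moreover have "vector [(r *\<^sub>R X)$1, (r *\<^sub>R X)$2, (r *\<^sub>R X)$3]
      = (r *\<^sub>R vector [X$1, X$2, X$3] :: real^3)" for X :: "real^4" and r
    by (simp add: vec_eq_iff forall_3)
  ultimately have lin: "linear h"
    by (intro linearI) (simp_all only: h_def matrix_vector_right_distrib
        matrix_vector_mult_scaleR vector_add_component vector_scaleR_component
        scaleR_add_left scaleR_add_right scaleR_scaleR real_scaleR_def ac_simps)
  have h_hom: "h (hom z t) = R *v z + t *\<^sub>R c" for z t
  proof -
    have "vector [hom z t $ 1, hom z t $ 2, hom z t $ 3] = z"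
      by (simp add: hom_def vec_eq_iff forall_3 vector_4 vector_3)
    then show ?thesis
      by (simp add: h_def) (simp add: hom_def vector_4)
  qed
  have Ph: "P *v h (hom z t) = z" for z t
    by (simp add: h_hom matrix_vector_right_distrib matrix_vector_mult_scaleR c(2)
        matrix_vector_mul_assoc R)
  have "X = 0" if "h X = 0" for X
  proof (cases X rule: hom_cases)
    case (1 z t)
    have "z = 0"
      using Ph[of z t] that 1 by simp
    then show ?thesis
      using that c(1) by (simp add: 1 h_hom hom_eq_0_iff)
  qed
  then have "inj h"
    using lin linear_injective_0 by blast
  moreover have eq: "(*v) (matrix h) = h"
    using lin by (simp add: matrix_works fun_eq_iff)
  moreover have "P ** matrix h = cam (mat 1) 0"
    by (rule cam_eqI) (simp add: matrix_vector_mul_assoc[symmetric] eq Ph)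
  ultimately show thesis
    using that[of "matrix h"] by simp
qed

section \<open>Solutions whose first camera is [I|0]\<close>

definition normal_triple ::
  "real^3^3 \<Rightarrow> real^3^3 \<Rightarrow> real^3^3 \<Rightarrow> real^3^3 \<Rightarrow> real^3 \<Rightarrow> real^3^3 \<Rightarrow> real^3 \<Rightarrow> bool"
  where "normal_triple F G K A a B b \<longleftrightarrow>
    camera (cam (mat 1) 0) \<and> camera (cam A a) \<and> camera (cam B b) \<and>
    epipolar F (cam (mat 1) 0) (cam A a) \<and> epipolar G (cam (mat 1) 0) (cam B b) \<and>
    epipolar K (cam A a) (cam B b)"

text \<open>One transformation, chosen to bring the first camera to [I|0], is applied to all three
  cameras.\<close>

lemma compatible_triple_normal_form:
  assumes "compatible {(i, j), (i, k), (j, k)} F"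
  shows "\<exists>A a B b. normal_triple (F i j) (F i k) (F j k) A a B b"
proof -
  obtain P where P: "camera (P i)" "camera (P j)" "camera (P k)"
    "epipolar (F i j) (P i) (P j)" "epipolar (F i k) (P i) (P k)" "epipolar (F j k) (P j) (P k)"
    using assms unfolding compatible_def scale_eq_psi_iff by auto
  obtain H where H: "inj ((*v) H)" "P i ** H = cam (mat 1) 0"
    using camera_normal_form[OF P(1)] .
  obtain A a where A: "P j ** H = cam A a"
    by (rule cam_cases)
  obtain B b where B: "P k ** H = cam B b"
    by (rule cam_cases)
  show ?thesis
    unfolding normal_triple_def
    using camera_mult[OF H(1) P(1)] camera_mult[OF H(1) P(2)] camera_mult[OF H(1) P(3)]
      epipolar_mult[OF H(1) P(4)] epipolar_mult[OF H(1) P(5)] epipolar_mult[OF H(1) P(6)]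
    unfolding H(2) A B by blast
qed

text \<open>The first camera forces X = (s x, r), so correspondence means s Ax + r a = t y. This is
  a linear dependence of y, Ax, a, detected by their triple product.\<close>

lemma corresponds_normal_iff:
  "corresponds (cam (mat 1) 0) (cam A a) x y \<longleftrightarrow> y \<bullet> cross3 (A *v x) a = 0"
proof
  assume "corresponds (cam (mat 1) 0) (cam A a) x y"
  then obtain X s t where X: "X \<noteq> 0 \<or> s \<noteq> 0 \<or> t \<noteq> 0"
    "cam (mat 1) 0 *v X = s *\<^sub>R x" "cam A a *v X = t *\<^sub>R y"
    unfolding corresponds_def by blast
  obtain z r where z: "X = hom z r"
    by (rule hom_cases)
  define u where "u = A *v x"
  let ?d = "y \<bullet> cross3 u a"
  have zx: "z = s *\<^sub>R x"
    using X(2) by (simp add: z cam_mult_hom)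
  then have eq: "s *\<^sub>R u + r *\<^sub>R a = t *\<^sub>R y"
    using X(3) by (simp add: z cam_mult_hom u_def matrix_vector_mult_scaleR)
  \<comment> \<open>As in Cramer's rule, each of s, r, t times the triple product is a triple
    product with a repeated vector. If \<open>?d\<close> were nonzero, all three and hence X would
    vanish.\<close>
  have "s * ?d = y \<bullet> cross3 (s *\<^sub>R u + r *\<^sub>R a) a"
    by (simp add: cross_add_left cross_mult_left)
  then have s: "s * ?d = 0"
    unfolding eq by (simp add: cross_mult_left dot_cross_self)
  have "r * ?d = y \<bullet> cross3 u (s *\<^sub>R u + r *\<^sub>R a)"
    by (simp add: cross_add_right cross_mult_right)
  then have r: "r * ?d = 0"
    unfolding eq by (simp add: cross_mult_right dot_cross_self)
  have "t * ?d = (s *\<^sub>R u + r *\<^sub>R a) \<bullet> cross3 u a"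
    unfolding eq by simp
  then have t: "t * ?d = 0"
    by (simp add: inner_left_distrib dot_cross_self)
  show "y \<bullet> cross3 (A *v x) a = 0"
    using X(1) s r t zx by (auto simp: z hom_eq_0_iff u_def)
next
  let ?M = "vector [y, A *v x, a] :: real^3^3"
  assume "y \<bullet> cross3 (A *v x) a = 0"
  then have "det (transpose ?M) = 0"
    by (simp add: dot_cross_det)
  \<comment> \<open>The entries of \<open>v\<close> are the coefficients of a dependence of y, Ax,
    a; they give t = -v1, s = v2, r = v3.\<close>
  then obtain v where v: "v \<noteq> 0" "transpose ?M *v v = 0"
    unfolding det_eq_0_iff_kernel by blast
  have "v$1 *\<^sub>R y + v$2 *\<^sub>R u + v$3 *\<^sub>R a
      = transpose (vector [y, u, a] :: real^3^3) *v v" for u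
    by (simp add: vec_eq_iff matrix_vector_mult_def sum_3 transpose_def mult.commute)
  then have "v$1 *\<^sub>R y + v$2 *\<^sub>R (A *v x) + v$3 *\<^sub>R a = 0"
    using v(2) by simp
  then have "v$2 *\<^sub>R (A *v x) + v$3 *\<^sub>R a = (- v$1) *\<^sub>R y"
    by (simp add: eq_neg_iff_add_eq_0 ac_simps)
  then have "cam A a *v hom (v$2 *\<^sub>R x) (v$3) = (- v$1) *\<^sub>R y"
    by (simp add: cam_mult_hom matrix_vector_mult_scaleR)
  moreover have "cam (mat 1) 0 *v hom (v$2 *\<^sub>R x) (v$3) = v$2 *\<^sub>R x"
    by (simp add: cam_mult_hom)
  moreover have "v$1 \<noteq> 0 \<or> v$2 \<noteq> 0 \<or> v$3 \<noteq> 0"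
    using v(1) by (auto simp: vec_eq_iff forall_3)
  then have "hom (v$2 *\<^sub>R x) (v$3) \<noteq> 0 \<or> v$2 \<noteq> 0 \<or> - v$1 \<noteq> 0"
    by (auto simp: hom_eq_0_iff)
  ultimately show "corresponds (cam (mat 1) 0) (cam A a) x y"
    unfolding corresponds_def by blast
qed

text \<open>Up to scale this is the classical formula that the transpose of F is the cross product
  matrix of a times A.\<close>

lemma epipolar_normal:
  assumes "epipolar F (cam (mat 1) 0) (cam A a)"
  obtains c where "c \<noteq> 0" "\<And>x. transpose F *v x = c *\<^sub>R cross3 (A *v x) a"
proof -
  have "linear (\<lambda>x. y \<bullet> cross3 (A *v x) a)" for y
    by (rule linearI) (simp_all add: matrix_vector_right_distrib matrix_vector_mult_scaleR
        cross_add_left cross_mult_left inner_right_distrib)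
  moreover have "linear (\<lambda>y. y \<bullet> cross3 (A *v x) a)" for x
    by (rule linearI) (simp_all add: inner_left_distrib)
  moreover have "x \<bullet> (F *v y) = 0 \<longleftrightarrow> y \<bullet> cross3 (A *v x) a = 0" for x y
    using assms by (simp add: epipolar_def corresponds_normal_iff)
  ultimately obtain c where c: "c \<noteq> 0"
      "\<And>x y. x \<bullet> (F *v y) = c * (y \<bullet> cross3 (A *v x) a)"
    using same_zeros_imp_proportional[of "\<lambda>x y. x \<bullet> (F *v y)" "\<lambda>x y. y \<bullet> cross3 (A *v x) a"]
    by (auto intro: linear_bilinear_form)
  have "y \<bullet> (transpose F *v x) = y \<bullet> (c *\<^sub>R cross3 (A *v x) a)" for x y
    using c(2)[of x y] by (simp add: dot_lmul_matrix[symmetric] transpose_matrix_vector inner_commute)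
  then have "transpose F *v x = c *\<^sub>R cross3 (A *v x) a" for x
    by (metis vector_eq_ldot)
  with c(1) that show thesis
    by blast
qed

text \<open>The coefficient is written as a projection so that it depends linearly on
  \<open>u\<close>.\<close>

lemma cross3_eq_0_imp:
  assumes "cross3 u a = 0" "a \<noteq> 0"
  shows "u = ((u \<bullet> a) / (a \<bullet> a)) *\<^sub>R a"
proof -
  have "collinear {0, a, u}"
    using assms(1) by (metis cross_eq_0 cross_refl cross_skew neg_equal_0_iff_equal)
  then obtain r where "u = r *\<^sub>R a"
    using assms(2) by (auto simp: collinear_lemma)
  then show ?thesis
    using assms(2) by simp
qed


lemma epipolar_translation_nonzero:
  assumes "epipolar F (cam (mat 1) 0) (cam A a)" "F \<noteq> 0"
  shows "a \<noteq> 0"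
proof
  assume "a = 0"
  then have "F = 0"
    by (intro epipolar_common_center[OF assms(1), of "hom 0 1"])
      (simp_all add: hom_eq_0_iff cam_mult_hom)
  with assms(2) show False ..
qed

lemma epipolar_translation_kernel:
  assumes "epipolar F (cam (mat 1) 0) (cam A a)"
  shows "F *v a = 0"
  using epipolar_epipole[OF assms, of "hom 0 1"] by (simp add: cam_mult_hom)

text \<open>The cross product of Ae and a vanishes, so the two are parallel. The factor \<alpha>
  locates the center of [A|a] at \<open>hom e (- \<alpha>)\<close>.\<close>

lemma epipole_multiple_translation:
  assumes F: "epipolar F (cam (mat 1) 0) (cam A a)" "F \<noteq> 0"
    and e: "spans_kernel e (transpose F)"
  obtains \<alpha> where "A *v e = \<alpha> *\<^sub>R a"
proof -
  obtain c where c: "c \<noteq> 0" "\<And>x. transpose F *v x = c *\<^sub>R cross3 (A *v x) a"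
    using epipolar_normal[OF F(1)] by blast
  have "e \<in> span {e}"
    by (simp add: span_base)
  then have "transpose F *v e = 0"
    using e unfolding spans_kernel_def by blast
  then have "cross3 (A *v e) a = 0"
    using c by simp
  then show thesis
    using that cross3_eq_0_imp epipolar_translation_nonzero[OF F] by blast
qed

text \<open>The pair \<open>[I|0], [A|a]\<close> is determined by its fundamental matrix up to the projective
  transformations that fix the first camera.\<close>

lemma epipolar_normal_unique:
  assumes F: "epipolar F (cam (mat 1) 0) (cam A a)" "epipolar F (cam (mat 1) 0) (cam C c)" "F \<noteq> 0"
    and e: "spans_kernel e F"
  obtains k s w where "k \<noteq> 0" "s \<noteq> 0" "c = s *\<^sub>R a"
    "\<And>x. A *v x = k *\<^sub>R (C *v x) + (w \<bullet> x) *\<^sub>R a"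
proof -
  have ac: "a \<noteq> 0" "c \<noteq> 0"
    using F epipolar_translation_nonzero by blast+
  have "a \<in> span {e}" "c \<in> span {e}"
    using e F epipolar_translation_kernel unfolding spans_kernel_def by blast+
  then obtain p q where pq: "a = p *\<^sub>R e" "c = q *\<^sub>R e"
    by (auto simp: span_singleton)
  define s where "s = q / p"
  have s: "s \<noteq> 0" "c = s *\<^sub>R a"
    using ac pq by (auto simp: s_def)
  obtain m where m: "m \<noteq> 0" "\<And>x. transpose F *v x = m *\<^sub>R cross3 (A *v x) a"
    using epipolar_normal[OF F(1)] by blast
  obtain n where n: "n \<noteq> 0" "\<And>x. transpose F *v x = n *\<^sub>R cross3 (C *v x) c"
    using epipolar_normal[OF F(2)] by blast
  \<comment> \<open>Substituting c = s a into the second formula makes the cross product of (A -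
    kC)x with a vanish for this \<open>k\<close>; \<open>w\<close> then represents the coefficient
    of a in (A - kC)x.\<close>
  define k where "k = n * s / m"
  define w where "w = (1 / (a \<bullet> a)) *\<^sub>R (transpose (A - k *\<^sub>R C) *v a)"
  have "A *v x = k *\<^sub>R (C *v x) + (w \<bullet> x) *\<^sub>R a" for x
  proof -
    have "m *\<^sub>R cross3 (A *v x) a = m *\<^sub>R cross3 (k *\<^sub>R (C *v x)) a"
      using m(1) m(2)[of x] n(2)[of x] unfolding s(2)
      by (simp add: k_def cross_mult_left cross_mult_right)
    then have "cross3 ((A - k *\<^sub>R C) *v x) a = 0"
      using m(1) by (simp add: matrix_vector_mult_diff_rdistrib Cross3.left_diff_distrib
          scaleR_matrix_vector_assoc[symmetric])
    then have "(A - k *\<^sub>R C) *v x = ((((A - k *\<^sub>R C) *v x) \<bullet> a) / (a \<bullet> a)) *\<^sub>R a"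
      using ac(1) by (rule cross3_eq_0_imp)
    also have "(((A - k *\<^sub>R C) *v x) \<bullet> a) / (a \<bullet> a) = w \<bullet> x"
      using dot_lmul_matrix[of a "A - k *\<^sub>R C" x]
      by (simp add: w_def transpose_matrix_vector inner_commute[of "(A - k *\<^sub>R C) *v x" a])
    finally have "(A - k *\<^sub>R C) *v x = (w \<bullet> x) *\<^sub>R a" .
    then have "A *v x - k *\<^sub>R (C *v x) = (w \<bullet> x) *\<^sub>R a"
      by (simp only: matrix_vector_mult_diff_rdistrib scaleR_matrix_vector_assoc[symmetric])
    then show ?thesis
      by (metis diff_add_cancel add.commute)
  qed
  moreover have "k \<noteq> 0"
    using m(1) n(1) s(1) by (simp add: k_def)
  ultimately show thesis
    using that s by blast
qed

text \<open>These are the transformations that take [I|0] to k[I|0].\<close>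

lemma cam_change_of_coordinates:
  assumes "k \<noteq> 0" "r \<noteq> 0"
  obtains H :: "real^4^4" where "inj ((*v) H)"
    "\<And>z t. H *v hom z t = hom (k *\<^sub>R z) (w \<bullet> z + r * t)"
proof -
  define H :: "real^4^4" where
    "H = vector [vector [k, 0, 0, 0], vector [0, k, 0, 0], vector [0, 0, k, 0],
      vector [w$1, w$2, w$3, r]]"
  have H: "H *v hom z t = hom (k *\<^sub>R z) (w \<bullet> z + r * t)" for z t
    by (simp add: H_def hom_def vec_eq_iff forall_4 vector_4 matrix_vector_mult_def sum_4
        inner_vec_def sum_3)
  have "X = 0" if "H *v X = 0" for X
    using that assms by (cases X rule: hom_cases) (auto simp: H hom_eq_0_iff)
  then have "inj ((*v) H)"
    using linear_injective_0[of "(*v) H"] by (simp add: matrix_vector_mul_linear)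
  with H that show thesis
    by blast
qed

text \<open>Two pairs that share the matrix \<open>G\<close> differ by a transformation fixing the
  first camera up to scale. Applied to the whole triple it replaces [B|b] by the prescribed [A|a],
  and the factor on the first camera is harmless.\<close>

lemma normal_triple_align:
  assumes T: "normal_triple F G K C c B b" and A: "epipolar G (cam (mat 1) 0) (cam A a)"
    and G: "G \<noteq> 0" "spans_kernel e G"
  shows "\<exists>D d. normal_triple F G K D d A a"
proof -
  have B: "epipolar G (cam (mat 1) 0) (cam B b)"
    using T by (simp add: normal_triple_def)
  obtain k s w where k: "k \<noteq> 0" "s \<noteq> 0" "b = s *\<^sub>R a"
    and AB: "\<And>x. A *v x = k *\<^sub>R (B *v x) + (w \<bullet> x) *\<^sub>R a"
    using epipolar_normal_unique[OF A B G] by blast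
  have "1 / s \<noteq> 0"
    using k(2) by simp
  then obtain H :: "real^4^4" where H: "inj ((*v) H)"
    "\<And>z t. H *v hom z t = hom (k *\<^sub>R z) ((1 / s) *\<^sub>R w \<bullet> z + (1 / s) * t)"
    using cam_change_of_coordinates[OF k(1)] by blast
  have B': "cam B b ** H = cam A a"
    using k by (intro cam_eqI) (simp add: matrix_vector_mul_assoc[symmetric] H(2) cam_mult_hom AB
        matrix_vector_mult_scaleR algebra_simps)
  have I': "cam (mat 1) 0 ** H = k *\<^sub>R cam (mat 1) 0"
  proof -
    have "(cam (mat 1) 0 ** H) *v X = (k *\<^sub>R cam (mat 1) 0) *v X" for X
      by (cases X rule: hom_cases)
        (simp add: matrix_vector_mul_assoc[symmetric] H(2) cam_mult_hom
          scaleR_matrix_vector_assoc[symmetric])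
    then show ?thesis
      by (simp add: matrix_eq)
  qed
  obtain D d where D: "cam C c ** H = cam D d"
    by (rule cam_cases)
  have "epipolar F (k *\<^sub>R cam (mat 1) 0) (cam D d)"
    using T epipolar_mult[OF H(1), of F "cam (mat 1) 0" "cam C c"] unfolding I' D
    by (simp add: normal_triple_def)
  then have "epipolar F (cam (mat 1) 0) (cam D d)"
    using epipolar_scale_left[OF k(1)] by blast
  then have "normal_triple F G K D d A a"
    using T A camera_mult[OF H(1), of "cam C c"] camera_mult[OF H(1), of "cam B b"]
      epipolar_mult[OF H(1), of K "cam C c" "cam B b"]
    unfolding B' D by (simp add: normal_triple_def)
  then show ?thesis
    by blast
qed

section \<open>Three cameras with collinear centers\<close>

text \<open>Here \<open>(e, - \<alpha>)\<close> and \<open>(e, - \<beta>)\<close> are the centers of \<open>[A|a]\<close> and \<open>[B|b]\<close>, on the line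
  through the center \<open>(0, 1)\<close> of \<open>[I|0]\<close>.\<close>

lemma collinear_no_common_center:
  assumes F: "epipolar F (cam (mat 1) 0) (cam A a)" "F \<noteq> 0"
    and G: "epipolar G (cam (mat 1) 0) (cam B b)" "G \<noteq> 0"
    and e: "spans_kernel e (transpose F)"
    and e_img: "A *v e = \<alpha> *\<^sub>R a" "B *v e = \<beta> *\<^sub>R b" "\<alpha> \<noteq> \<beta>"
    and X: "cam A a *v X = 0" "cam B b *v X = 0"
  shows "X = 0"
proof -
  obtain z t where z: "X = hom z t"
    by (rule hom_cases)
  obtain c where c: "c \<noteq> 0" "\<And>x. transpose F *v x = c *\<^sub>R cross3 (A *v x) a"
    using epipolar_normal[OF F(1)] by blast
  have "A *v z = (- t) *\<^sub>R a"
    using X(1) by (simp add: z cam_mult_hom eq_neg_iff_add_eq_0)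
  \<comment> \<open>Az is parallel to a, so the cross product formula puts z in the kernel spanned
    by e; the two images then give linear equations for r and t.\<close>
  then have "transpose F *v z = 0"
    unfolding c(2) by (simp only: cross_mult_left cross_refl scaleR_zero_right)
  then have "z \<in> span {e}"
    using e unfolding spans_kernel_def by blast
  then obtain r where r: "z = r *\<^sub>R e"
    by (auto simp: span_singleton)
  have "(r * \<alpha> + t) *\<^sub>R a = 0" "(r * \<beta> + t) *\<^sub>R b = 0"
    using X by (simp_all add: z r cam_mult_hom matrix_vector_mult_scaleR e_img scaleR_add_left)
  then have "r * \<alpha> + t = 0" "r * \<beta> + t = 0"
    using epipolar_translation_nonzero[OF F] epipolar_translation_nonzero[OF G] by auto
  moreover from this have "r * (\<alpha> - \<beta>) = 0"
    unfolding right_diff_distrib by linarith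
  ultimately have "r = 0" "t = 0"
    using e_img(3) by auto
  then show ?thesis
    by (simp add: z r hom_eq_0_iff)
qed

text \<open>A point may be moved along the plane spanned by it and the baseline; the two parameters
  are chosen to correct the two images, which is possible as the centers differ.\<close>

lemma collinear_corresponds_transfer:
  assumes F: "epipolar F (cam (mat 1) 0) (cam A a)" "epipolar F (cam (mat 1) 0) (cam C c)"
      "F \<noteq> 0" "spans_kernel f F"
    and G: "epipolar G (cam (mat 1) 0) (cam B b)" "epipolar G (cam (mat 1) 0) (cam D d)"
      "G \<noteq> 0" "spans_kernel g G"
    and e: "spans_kernel e (transpose F)"
    and AB: "A *v e = \<alpha> *\<^sub>R a" "B *v e = \<beta> *\<^sub>R b" "\<alpha> \<noteq> \<beta>"
    and CD: "C *v e = \<gamma> *\<^sub>R c" "D *v e = \<delta> *\<^sub>R d" "\<gamma> \<noteq> \<delta>"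
    and corr: "corresponds (cam C c) (cam D d) x y"
  shows "corresponds (cam A a) (cam B b) x y"
proof -
  obtain X s t where X: "X \<noteq> 0 \<or> s \<noteq> 0 \<or> t \<noteq> 0"
    "cam C c *v X = s *\<^sub>R x" "cam D d *v X = t *\<^sub>R y"
    using corr unfolding corresponds_def by blast
  \<comment> \<open>Otherwise X would be a common center of [C|c] and [D|d].\<close>
  have st: "s \<noteq> 0 \<or> t \<noteq> 0"
    using X collinear_no_common_center[OF F(2,3) G(2,3) e CD, of X] by auto
  obtain z r where z: "X = hom z r"
    by (rule hom_cases)
  obtain k u w where k: "k \<noteq> 0" "u \<noteq> 0" "c = u *\<^sub>R a"
    "\<And>x. A *v x = k *\<^sub>R (C *v x) + (w \<bullet> x) *\<^sub>R a"
    using epipolar_normal_unique[OF F] by blast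
  obtain l u' w' where l: "l \<noteq> 0" "u' \<noteq> 0" "d = u' *\<^sub>R b"
    "\<And>x. B *v x = l *\<^sub>R (D *v x) + (w' \<bullet> x) *\<^sub>R b"
    using epipolar_normal_unique[OF G] by blast
  \<comment> \<open>The numbers \<open>m\<close> and \<open>n\<close> are the coefficients for which
    Az + m a and Bz + n b are the given images of X up to the factors k and l. Moving z by \<tau> e
    contributes \<tau> \<alpha> and \<tau> \<beta> to them.\<close>
  define m where "m = k * u * r - w \<bullet> z"
  define n where "n = l * u' * r - w' \<bullet> z"
  define \<tau> where "\<tau> = (m - n) / (\<alpha> - \<beta>)"
  define \<rho> where "\<rho> = m - \<tau> * \<alpha>"
  have "\<tau> * (\<alpha> - \<beta>) = m - n"
    using AB(3) by (simp add: \<tau>_def)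
  then have \<rho>: "\<tau> * \<alpha> + \<rho> = m" "\<tau> * \<beta> + \<rho> = n"
    by (simp_all add: \<rho>_def algebra_simps)
  have "cam A a *v hom (z + \<tau> *\<^sub>R e) \<rho> = A *v z + (\<tau> * \<alpha> + \<rho>) *\<^sub>R a"
    by (simp add: cam_mult_hom matrix_vector_right_distrib matrix_vector_mult_scaleR AB(1)
        algebra_simps)
  also have "\<dots> = k *\<^sub>R (cam C c *v X)"
    unfolding \<rho> by (simp add: m_def z cam_mult_hom k algebra_simps)
  also have "\<dots> = (k * s) *\<^sub>R x"
    by (simp add: X(2))
  finally have 1: "cam A a *v hom (z + \<tau> *\<^sub>R e) \<rho> = (k * s) *\<^sub>R x" .
  have "cam B b *v hom (z + \<tau> *\<^sub>R e) \<rho> = B *v z + (\<tau> * \<beta> + \<rho>) *\<^sub>R b"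
    by (simp add: cam_mult_hom matrix_vector_right_distrib matrix_vector_mult_scaleR AB(2)
        algebra_simps)
  also have "\<dots> = l *\<^sub>R (cam D d *v X)"
    unfolding \<rho> by (simp add: n_def z cam_mult_hom l algebra_simps)
  also have "\<dots> = (l * t) *\<^sub>R y"
    by (simp add: X(3))
  finally have 2: "cam B b *v hom (z + \<tau> *\<^sub>R e) \<rho> = (l * t) *\<^sub>R y" .
  have "k * s \<noteq> 0 \<or> l * t \<noteq> 0"
    using st k(1) l(1) by simp
  with 1 2 show ?thesis
    unfolding corresponds_def by blast
qed

lemma span_singleton_scale:
  assumes "c \<noteq> 0"
  shows "span {c *\<^sub>R x} = span {x}"
proof (rule antisym)
  show "span {c *\<^sub>R x} \<subseteq> span {x}"
    by (intro span_minimal) (simp_all add: span_scale span_base)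
  have "(1 / c) *\<^sub>R c *\<^sub>R x \<in> span {c *\<^sub>R x}"
    by (intro span_scale span_base) simp
  then show "span {x} \<subseteq> span {c *\<^sub>R x}"
    using assms by (intro span_minimal) simp_all
qed

lemma spans_kernel_nonzero:
  assumes "rank F = 2" "spans_kernel e F"
  shows "e \<noteq> 0"
proof
  assume "e = 0"
  moreover obtain x where "x \<noteq> 0" "F *v x = 0"
    using matrix_nonfull_linear_equations_eq[of F] assms(1) by auto
  ultimately show False
    using assms(2) unfolding spans_kernel_def by auto
qed

text \<open>Since \<open>K\<close> is nonzero, the cameras [C|c] and [D|d] have distinct centers
  too. The transfer of correspondences therefore works in both directions.\<close>

lemma normal_triple_collinear:
  assumes T: "normal_triple F G K C c D d" and K: "K \<noteq> 0"
    and F: "epipolar F (cam (mat 1) 0) (cam A a)" "rank F = 2" "spans_kernel f F"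
    and G: "epipolar G (cam (mat 1) 0) (cam B b)" "rank G = 2" "spans_kernel g G"
    and e: "spans_kernel e (transpose F)" "spans_kernel e (transpose G)"
    and AB: "A *v e = \<alpha> *\<^sub>R a" "B *v e = \<beta> *\<^sub>R b" "\<alpha> \<noteq> \<beta>"
  shows "epipolar K (cam A a) (cam B b)"
proof -
  have C: "epipolar F (cam (mat 1) 0) (cam C c)" and D: "epipolar G (cam (mat 1) 0) (cam D d)"
    and CD: "epipolar K (cam C c) (cam D d)"
    using T by (simp_all add: normal_triple_def)
  have F0: "F \<noteq> 0" and G0: "G \<noteq> 0"
    using F(2) G(2) by auto
  obtain \<gamma> where \<gamma>: "C *v e = \<gamma> *\<^sub>R c"
    using epipole_multiple_translation[OF C F0 e(1)] .
  obtain \<delta> where \<delta>: "D *v e = \<delta> *\<^sub>R d"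
    using epipole_multiple_translation[OF D G0 e(2)] .
  have "e \<noteq> 0"
    using spans_kernel_nonzero[OF _ e(1)] F(2) by (simp add: rank_transpose)
  have "\<gamma> \<noteq> \<delta>"
  proof
    assume "\<gamma> = \<delta>"
    then have "K = 0"
      using \<open>e \<noteq> 0\<close> by (intro epipolar_common_center[OF CD, of "hom e (- \<gamma>)"])
        (simp_all add: cam_mult_hom \<gamma> \<delta> hom_eq_0_iff)
    with K show False ..
  qed
  then have "corresponds (cam C c) (cam D d) x y \<longleftrightarrow> corresponds (cam A a) (cam B b) x y" for x y
    using collinear_corresponds_transfer[OF F(1) C F0 F(3) G(1) D G0 G(3) e(1) AB \<gamma> \<delta>]
      collinear_corresponds_transfer[OF C F(1) F0 F(3) D G(1) G0 G(3) e(1) \<gamma> \<delta> _ AB]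
    by blast
  with CD show ?thesis
    by (simp add: epipolar_def)
qed

section \<open>Gluing the solutions of the triples\<close>

theorem theorem3p13:
  fixes F :: "nat \<Rightarrow> nat \<Rightarrow> real^3^3" and e :: "nat \<Rightarrow> nat \<Rightarrow> real^3"
  assumes fundamental: "\<And>i j. 1 \<le> i \<Longrightarrow> i < j \<Longrightarrow> j \<le> 4 \<Longrightarrow> fundamental_matrix (F i j)"
    and convention: "\<And>i j. 1 \<le> i \<Longrightarrow> i < j \<Longrightarrow> j \<le> 4 \<Longrightarrow> F j i = transpose (F i j)"
    and epipoles: "\<And>i j. i \<in> {1..4} \<Longrightarrow> j \<in> {1..4} \<Longrightarrow> i \<noteq> j \<Longrightarrow> spans_kernel (e j i) (F i j)"
    and image1: "scale_eq (e 1 2) (e 1 3)" "\<not> scale_eq (e 1 3) (e 1 4)"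
    and image2: "scale_eq (e 2 1) (e 2 3)" "\<not> scale_eq (e 2 3) (e 2 4)"
    and image3: "scale_eq (e 3 1) (e 3 2)" "\<not> scale_eq (e 3 2) (e 3 4)"
    and image4: "\<not> scale_eq (e 4 1) (e 4 2)" "\<not> scale_eq (e 4 1) (e 4 3)"
      "\<not> scale_eq (e 4 2) (e 4 3)" "on_common_line {e 4 1, e 4 2, e 4 3}"
  shows "compatible {(i, j). 1 \<le> i \<and> i < j \<and> j \<le> 4} F \<longleftrightarrow>
    (\<forall>i \<in> {1..4}. \<forall>j \<in> {1..4}. \<forall>k \<in> {1..4}. i \<noteq> j \<longrightarrow> i \<noteq> k \<longrightarrow> j \<noteq> k \<longrightarrow>
      compatible {(i, j), (i, k), (j, k)} F)"
proof
  let ?E = "{(i, j). 1 \<le> i \<and> i < j \<and> j \<le> (4::nat)}"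
  assume "compatible ?E F"
  then obtain P where "(\<forall>i \<in> fst ` ?E \<union> snd ` ?E. camera (P i)) \<and>
      (\<forall>(i, j) \<in> ?E. epipolar (F i j) (P i) (P j))"
    unfolding compatible_def scale_eq_psi_iff ..
  then have cams: "\<forall>i \<in> fst ` ?E \<union> snd ` ?E. camera (P i)"
    and P: "\<forall>(i, j) \<in> ?E. epipolar (F i j) (P i) (P j)"
    by (rule conjunct1, rule conjunct2)
  \<comment> \<open>The index 4 occurs only as a second component of a pair, every other index as a
    first one.\<close>
  have cam: "camera (P i)" if "i \<in> {1..4}" for i
  proof (cases "i = 4")
    case True
    have "(1::nat, i) \<in> ?E"
      using True by simp
    from bspec[OF cams UnI2[OF imageI[OF this]]] show ?thesis
      by (simp only: snd_conv)
  next
    case False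
    have "(i, 4) \<in> ?E"
      using that False by simp
    from bspec[OF cams UnI1[OF imageI[OF this]]] show ?thesis
      by (simp only: fst_conv)
  qed
  have epi: "epipolar (F i j) (P i) (P j)" if "i \<in> {1..4}" "j \<in> {1..4}" "i \<noteq> j" for i j
  proof (cases "i < j")
    case True
    then have "(i, j) \<in> ?E"
      using that by simp
    then show ?thesis
      using P[THEN bspec, of "(i, j)"] by simp
  next
    case False
    then have "(j, i) \<in> ?E"
      using that by simp
    then have "epipolar (F j i) (P j) (P i)" "F i j = transpose (F j i)"
      using P[THEN bspec, of "(j, i)"] convention[of j i] by simp_all
    then show ?thesis
      using epipolar_transpose[of "F j i" "P j" "P i"] by (simp only:)
  qed
  show "\<forall>i \<in> {1..4}. \<forall>j \<in> {1..4}. \<forall>k \<in> {1..4}. i \<noteq> j \<longrightarrow> i \<noteq> k \<longrightarrow> j \<noteq> k \<longrightarrow>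
      compatible {(i, j), (i, k), (j, k)} F"
  proof (intro ballI impI)
    fix i j k :: nat
    assume "i \<in> {1..4}" "j \<in> {1..4}" "k \<in> {1..4}" "i \<noteq> j" "i \<noteq> k" "j \<noteq> k"
    then show "compatible {(i, j), (i, k), (j, k)} F"
      unfolding compatible_def scale_eq_psi_iff
      by (intro exI[of _ P]) (simp add: cam epi)
  qed
next
  assume triples: "\<forall>i \<in> {1..4}. \<forall>j \<in> {1..4}. \<forall>k \<in> {1..4}. i \<noteq> j \<longrightarrow> i \<noteq> k \<longrightarrow> j \<noteq> k \<longrightarrow>
      compatible {(i, j), (i, k), (j, k)} F"
  then have triple: "compatible {(i, j), (i, k), (j, k)} F"
    if "1 \<le> i" "i < j" "j < k" "k \<le> 4" for i j k
    using that by simp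
  have rank: "rank (F i j) = 2" if "1 \<le> i" "i < j" "j \<le> 4" for i j
    using fundamental[OF that] by (simp add: fundamental_matrix_def)
  have nz: "F i j \<noteq> 0" if "1 \<le> i" "i < j" "j \<le> 4" for i j
    using rank[OF that] by auto
  have ker: "spans_kernel (e j i) (F i j)" if "1 \<le> i" "i < j" "j \<le> 4" for i j
    using that by (intro epipoles) auto
  have ker': "spans_kernel (e i j) (transpose (F i j))" if "1 \<le> i" "i < j" "j \<le> 4" for i j
    using that epipoles[of j i] convention[OF that] by auto
  obtain A2 a2 A4 a4 where T2: "normal_triple (F 1 2) (F 1 4) (F 2 4) A2 a2 A4 a4"
    using compatible_triple_normal_form[OF triple[of 1 2 4]] by auto
  obtain B3 b3 B4 b4 where "normal_triple (F 1 3) (F 1 4) (F 3 4) B3 b3 B4 b4"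
    using compatible_triple_normal_form[OF triple[of 1 3 4]] by auto
  moreover have "epipolar (F 1 4) (cam (mat 1) 0) (cam A4 a4)"
    using T2 by (simp add: normal_triple_def)
  \<comment> \<open>The solution for 134 is moved so that its camera 4 becomes the one chosen for
    124.\<close>
  ultimately obtain A3 a3 where T3: "normal_triple (F 1 3) (F 1 4) (F 3 4) A3 a3 A4 a4"
    using normal_triple_align[of "F 1 3" "F 1 4" "F 3 4" B3 b3 B4 b4 A4 a4 "e 4 1"]
      nz[of 1 4] ker[of 1 4]
    by (simp del: One_nat_def) blast
  \<comment> \<open>These cameras do not enter the final family; they certify which correspondence
    between images 2 and 3 belongs to \<open>F 2 3\<close>.\<close>
  obtain C c D d where T: "normal_triple (F 1 2) (F 1 3) (F 2 3) C c D d"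
    using compatible_triple_normal_form[OF triple[of 1 2 3]] by auto
  have E12: "epipolar (F 1 2) (cam (mat 1) 0) (cam A2 a2)"
    and E24: "epipolar (F 2 4) (cam A2 a2) (cam A4 a4)"
    and E13: "epipolar (F 1 3) (cam (mat 1) 0) (cam A3 a3)"
    and E34: "epipolar (F 3 4) (cam A3 a3) (cam A4 a4)"
    using T2 T3 by (simp_all add: normal_triple_def)
  \<comment> \<open>One representative of the shared epipole in image 1 is used for both kernels;
    \<open>e 1 2\<close> is a nonzero multiple of it.\<close>
  let ?e = "e 1 3"
  have e3: "spans_kernel ?e (transpose (F 1 3))"
    using ker'[of 1 3] by simp
  obtain r where "r \<noteq> 0" "e 1 2 = r *\<^sub>R ?e"
    using image1(1) unfolding scale_eq_def by blast
  then have "span {e 1 2} = span {?e}"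
    using span_singleton_scale by simp
  then have e2: "spans_kernel ?e (transpose (F 1 2))"
    using ker'[of 1 2] by (simp add: spans_kernel_def)
  have e0: "?e \<noteq> 0"
    using spans_kernel_nonzero[OF _ e3] rank[of 1 3] by (simp add: rank_transpose)
  obtain \<alpha> where \<alpha>: "A2 *v ?e = \<alpha> *\<^sub>R a2"
    using epipole_multiple_translation[OF E12 _ e2] nz[of 1 2] by auto
  obtain \<beta> where \<beta>: "A3 *v ?e = \<beta> *\<^sub>R a3"
    using epipole_multiple_translation[OF E13 _ e3] nz[of 1 3] by auto
  have "\<alpha> \<noteq> \<beta>"
  proof
    \<comment> \<open>Cameras 2 and 3 would have the same center and hence the same epipole in image 4.\<close>
    assume "\<alpha> = \<beta>"
    define X where "X = hom ?e (- \<alpha>)"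
    have X: "X \<noteq> 0" "cam A2 a2 *v X = 0" "cam A3 a3 *v X = 0"
      using e0 \<open>\<alpha> = \<beta>\<close> by (simp_all add: X_def hom_eq_0_iff cam_mult_hom \<alpha> \<beta> del: One_nat_def)
    define u where "u = cam A4 a4 *v X"
    have "u \<noteq> 0"
      using epipolar_common_center[OF E24 X(1,2)] nz[of 2 4] by (auto simp: u_def)
    have "u \<in> span {e 4 2}" "u \<in> span {e 4 3}"
      using epipolar_epipole[OF E24 X(2)] epipolar_epipole[OF E34 X(3)] ker[of 2 4] ker[of 3 4]
      by (auto simp: spans_kernel_def u_def)
    then obtain p q where pq: "u = p *\<^sub>R e 4 2" "u = q *\<^sub>R e 4 3"
      unfolding span_singleton by (elim rangeE)
    then have "p \<noteq> 0" "q \<noteq> 0"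
      using \<open>u \<noteq> 0\<close> by auto
    moreover have "e 4 2 = (1 / p) *\<^sub>R p *\<^sub>R e 4 2"
      using \<open>p \<noteq> 0\<close> by simp
    then have "e 4 2 = (q / p) *\<^sub>R e 4 3"
      unfolding pq(1)[symmetric] unfolding pq(2) by simp
    ultimately have "q / p \<noteq> 0" "e 4 2 = (q / p) *\<^sub>R e 4 3"
      by simp_all
    then show False
      using image4(3) unfolding scale_eq_def by blast
  qed
  then have E23: "epipolar (F 2 3) (cam A2 a2) (cam A3 a3)"
    using normal_triple_collinear[OF T nz[of 2 3] E12 rank[of 1 2] ker[of 1 2]
        E13 rank[of 1 3] ker[of 1 3] e2 e3 \<alpha> \<beta>] by simp
  define P where "P = (\<lambda>i::nat. if i = 1 then cam (mat 1) 0 else if i = 2 then cam A2 a2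
    else if i = 3 then cam A3 a3 else cam A4 a4)"
  have "camera (P i)" for i
    using T2 T3 by (auto simp: P_def normal_triple_def)
  moreover have "epipolar (F i j) (P i) (P j)" if "1 \<le> i" "i < j" "j \<le> 4" for i j
  proof -
    have "(i, j) \<in> {(1, 2), (1, 3), (1, 4), (2, 3), (2, 4), (3, 4)}"
      using that by auto
    then show ?thesis
      using T2 T3 E23 by (auto simp: P_def normal_triple_def)
  qed
  ultimately show "compatible {(i, j). 1 \<le> i \<and> i < j \<and> j \<le> 4} F"
    unfolding compatible_def scale_eq_psi_iff by (intro exI[of _ P]) simp
qed

end
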